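(* Let $0\le\delta<1$, $\varphi\in\mathcal{S}^*(\delta)$, $\beta\ge0$, $\theta\in[0,\pi)$, and let $F^\theta_{\alpha\beta}$ be a sense-preserving harmonic mapping in $\mathbb{D}$ which is the horizontal shear of $C^\theta_{\alpha\beta}[\varphi]$ with dilatation $w_{\alpha\beta}(z)=\alpha(1+\beta)z/2$. If $$\alpha\in\Big[0,\frac{1}{(1+\beta)\sqrt2}\Big],$$ then $F^\theta_{\alpha\beta}\in\mathcal{SHCC}$.
   Context: $\mathbb{D}=\{z\in\mathbb{C}:|z|<1\}$, $\mathbb{T}=\{z:|z|=1\}$. For $0\le\delta<1$, $\mathcal{S}^*(\delta)$ is the class of analytic functions $\varphi$ in $\mathbb{D}$ with $\varphi(0)=0$, $\varphi'(0)=1$ and $\mathrm{Re}\,[z\varphi'(z)/\varphi(z)]>\delta$ for all $z\in\mathbb{D}$. Define $$C_{\alpha\beta}[\varphi](z)=\int_0^z\Big(\frac{\varphi(\zeta)}{\zeta(1-\zeta)^{\beta}}\Big)^{\alpha}\,d\zeta,\qquad C^\theta_{\alpha\beta}[\varphi](z)=e^{-i\theta}C_{\alpha\beta}[\varphi](e^{i\theta}z),\qquad z\in\mathbb{D},$$ with the analytic branches of the powers for which the integrand equals $1$ at $\zeta=0$. The horizontal shear of $C^\theta_{\alpha\beta}[\varphi]$ with dilatation $w_{\alpha\beta}$ is the harmonic mapping $F^\theta_{\alpha\beta}=H+\overline{G}$, with $H,G$ analytic in $\mathbb{D}$, $H-G=C^\theta_{\alpha\beta}[\varphi]$, $G'=w_{\alpha\beta}H'$,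 and normalization $H(0)=G(0)=0$, $H'(0)=1$, $G'(0)=0$. It is sense-preserving if $|H'|^2-|G'|^2>0$ in $\mathbb{D}$. A harmonic mapping in $\mathbb{D}$ is close-to-convex if it is univalent and its image of $\mathbb{D}$ is a close-to-convex domain (its complement in $\mathbb{C}$ is a union of non-crossing closed half-lines). A sense-preserving harmonic mapping $f=h+\overline{g}$ in $\mathbb{D}$ is stable harmonic close-to-convex, written $f\in\mathcal{SHCC}$, if all mappings $f_\lambda=h+\lambda\overline{g}$, $\lambda\in\mathbb{T}$, are close-to-convex in $\mathbb{D}$. *)

theory Defs
  imports "HOL-Complex_Analysis.Complex_Analysis"
begin

abbreviation unit_disc :: "complex set"
  where "unit_disc \<equiv> ball 0 1"

(* The quotient z * phi' z / phi z has a removable singularity at 0, where its value is 1 and the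
   inequality holds trivially since delta < 1; HOL's 0 / 0 = 0 forces us to leave out that point. *)
definition starlike_of_order :: "real \<Rightarrow> (complex \<Rightarrow> complex) set"
  where "starlike_of_order \<delta> =
    {\<phi>. \<phi> holomorphic_on unit_disc \<and> \<phi> 0 = 0 \<and> deriv \<phi> 0 = 1 \<and>
        (\<forall>z\<in>unit_disc - {0}. \<phi> z \<noteq> 0 \<and> Re (z * deriv \<phi> z / \<phi> z) > \<delta>)}"

(* For f holomorphic and zero-free in the disc with f 0 = 1, the logarithm L exists and is unique
   on the disc, so this is the analytic branch of the power of f with value 1 at 0. *)
definition power_branch :: "(complex \<Rightarrow> complex) \<Rightarrow> real \<Rightarrow> complex \<Rightarrow> complex"
  where "power_branch f a z =
    exp (of_real a *
      (SOME L. L holomorphic_on unit_disc \<and> L 0 = 0 \<and> (\<forall>\<zeta>\<in>unit_disc. exp (L \<zeta>) = f \<zeta>)) z)"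

(* The value at 0 fills in the removable singularity of phi z / z.  As Re (1 - z) > 0 in the disc,
   powr (the principal branch) is the analytic branch of (1 - z)^beta with value 1 at 0. *)
definition C_base :: "real \<Rightarrow> (complex \<Rightarrow> complex) \<Rightarrow> complex \<Rightarrow> complex"
  where "C_base \<beta> \<phi> z =
    (if z = 0 then deriv \<phi> 0 else \<phi> z / z) / (1 - z) powr of_real \<beta>"

definition C_op :: "real \<Rightarrow> real \<Rightarrow> (complex \<Rightarrow> complex) \<Rightarrow> complex \<Rightarrow> complex"
  where "C_op \<alpha> \<beta> \<phi> z = contour_integral (linepath 0 z) (power_branch (C_base \<beta> \<phi>) \<alpha>)"

definition C_rot :: "real \<Rightarrow> real \<Rightarrow> real \<Rightarrow> (complex \<Rightarrow> complex) \<Rightarrow> complex \<Rightarrow> complex"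
  where "C_rot \<theta> \<alpha> \<beta> \<phi> z = exp (- \<i> * of_real \<theta>) * C_op \<alpha> \<beta> \<phi> (exp (\<i> * of_real \<theta>) * z)"

definition harmonic_decomp ::
  "(complex \<Rightarrow> complex) \<Rightarrow> (complex \<Rightarrow> complex) \<Rightarrow> (complex \<Rightarrow> complex) \<Rightarrow> bool"
  where "harmonic_decomp f h g \<longleftrightarrow>
    h holomorphic_on unit_disc \<and> g holomorphic_on unit_disc \<and>
    (\<forall>z\<in>unit_disc. f z = h z + cnj (g z))"

(* On the (simply connected) disc every complex-valued harmonic function has this form. *)
definition harmonic_mapping :: "(complex \<Rightarrow> complex) \<Rightarrow> bool"
  where "harmonic_mapping f \<longleftrightarrow> (\<exists>h g. harmonic_decomp f h g)"

(* The functions h and g are determined by f up to additive constants, so h' and g' are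
   determined by f. *)
definition sense_preserving :: "(complex \<Rightarrow> complex) \<Rightarrow> bool"
  where "sense_preserving f \<longleftrightarrow>
    (\<exists>h g. harmonic_decomp f h g \<and>
      (\<forall>z\<in>unit_disc. (cmod (deriv h z))\<^sup>2 - (cmod (deriv g z))\<^sup>2 > 0))"

definition horizontal_shear ::
  "(complex \<Rightarrow> complex) \<Rightarrow> (complex \<Rightarrow> complex) \<Rightarrow> (complex \<Rightarrow> complex) \<Rightarrow> bool"
  where "horizontal_shear F c w \<longleftrightarrow>
    (\<exists>H G. harmonic_decomp F H G \<and>
      (\<forall>z\<in>unit_disc. H z - G z = c z) \<and>
      (\<forall>z\<in>unit_disc. deriv G z = w z * deriv H z) \<and>
      H 0 = 0 \<and> G 0 = 0 \<and> deriv H 0 = 1 \<and> deriv G 0 = 0)"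

definition closed_ray :: "complex \<Rightarrow> complex \<Rightarrow> complex set"
  where "closed_ray a d = {a + of_real t * d | t. t \<ge> 0}"

definition open_ray :: "complex \<Rightarrow> complex \<Rightarrow> complex set"
  where "open_ray a d = {a + of_real t * d | t. t > 0}"

(* Half-lines are given by origin and direction.  Non-crossing means that two different half-lines
   of the family meet at most in an origin of one of them. *)
definition close_to_convex_domain :: "complex set \<Rightarrow> bool"
  where "close_to_convex_domain S \<longleftrightarrow>
    open S \<and> connected S \<and> S \<noteq> {} \<and>
    (\<exists>R. (\<forall>(a, d)\<in>R. d \<noteq> 0) \<and>
         (\<forall>(a, d)\<in>R. \<forall>(b, e)\<in>R. (a, d) \<noteq> (b, e) \<longrightarrow> open_ray a d \<inter> open_ray b e = {}) \<and>
         - S = (\<Union>(a, d)\<in>R. closed_ray a d))"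

definition close_to_convex_mapping :: "(complex \<Rightarrow> complex) \<Rightarrow> bool"
  where "close_to_convex_mapping f \<longleftrightarrow>
    harmonic_mapping f \<and> inj_on f unit_disc \<and> close_to_convex_domain (f ` unit_disc)"

(* A different choice of the additive constants in h and g only translates the mappings
   h + \<mu> cnj g, so the existential quantifier does not depend on that choice. *)
definition SHCC :: "(complex \<Rightarrow> complex) set"
  where "SHCC =
    {f. sense_preserving f \<and>
        (\<exists>h g. harmonic_decomp f h g \<and>
          (\<forall>\<mu>\<in>sphere 0 1. close_to_convex_mapping (\<lambda>z. h z + \<mu> * cnj (g z))))}"

end

theory Submission imports Defs begin

text \<open>
  Write \<open>F = H + cnj G\<close> and \<open>f = H - G\<close>, so that \<open>f\<close> is the rotated integral transform.  Up to the
  rotation, \<open>z f''/f' = \<alpha> (z \<phi>'/\<phi> - 1 + \<beta> z / (1 - z))\<close>, whose real part is at least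
  \<open>- \<alpha> (1 + \<beta> / 2) > - 1\<close>.  By the classical criterion (\<open>convex_univalent_criterion\<close>) \<open>f\<close> maps the
  disc univalently onto a convex domain \<open>\<Omega>\<close>.

  Fix \<open>\<mu>\<close> of modulus 1 and transport \<open>H + \<mu> cnj G\<close> to \<open>\<Omega>\<close>: put \<open>\<Phi> = (H + \<mu> cnj G) \<circ> f\<^sup>-\<^sup>1\<close>.  Since
  \<open>f' = (1 - w) H'\<close> and \<open>G' = w H'\<close>, the real derivative of \<open>\<Phi>\<close> is \<open>d \<mapsto> p d + \<mu> cnj (q d)\<close> with
  \<open>p = 1 / (1 - w)\<close> and \<open>q = w / (1 - w)\<close>.  The dilatation is bounded by some \<open>c \<le> sqrt 2 / 4\<close>, and
  \<open>Re p - \<bar>q\<bar> \<ge> 1 / (1 + c) - c / (1 - c) > 0\<close> because \<open>c < sqrt 2 - 1\<close>.  Integrating along segments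
  of the convex set \<open>\<Omega>\<close> shows that \<open>\<Phi>\<close> is Lipschitz and strongly monotone.

  Such a map has a close-to-convex image (\<open>strongly_monotone_image_close_to_convex\<close>).  Extend \<open>\<Phi>\<close>
  to the closure of \<open>\<Omega>\<close>, let \<open>P\<close> be the nearest-point projection onto this closure, and put
  \<open>\<Psi> u = \<Phi> (P u) + (u - P u)\<close>.  Monotonicity makes \<open>\<Psi>\<close> a homeomorphism of the plane, and \<open>\<Psi>\<close>
  carries each outer normal ray of \<open>\<Omega>\<close> to a half-line by a translation.  The outer normal rays fill the
  complement of \<open>\<Omega>\<close> without crossing, so their images do the same for the complement of \<open>\<Phi> ` \<Omega>\<close>.
\<close>

section \<open>Local analytic sections\<close>

text \<open>
  A branch of the inverse of \<open>f\<close> on a convex open set, with values in \<open>U\<close>.  Convexity of the domains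
  is required so that any two of them meet in a connected set, on which branches can be compared.
\<close>
definition convex_section :: "(complex \<Rightarrow> complex) \<Rightarrow> complex set \<Rightarrow> complex set \<Rightarrow> (complex \<Rightarrow> complex) \<Rightarrow> bool"
  where "convex_section f U T g \<longleftrightarrow>
    open T \<and> convex T \<and> g holomorphic_on T \<and> g ` T \<subseteq> U \<and> (\<forall>w\<in>T. f (g w) = w)"

lemma convex_section_subset:
  assumes "convex_section f U T g" "T' \<subseteq> T" "open T'" "convex T'"
  shows "convex_section f U T' g"
  using assms unfolding convex_section_def by (blast intro: holomorphic_on_subset)

text \<open>
  The set where two branches agree is closed by continuity and open because \<open>f\<close> is locally injective;
  the common domain is convex, hence connected.
\<close>
lemma convex_section_unique:
  assumes f: "f holomorphic_on U" "open U" "\<forall>z\<in>U. deriv f z \<noteq> 0"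
    and g: "convex_section f U T1 g1" "convex_section f U T2 g2"
    and w0: "w0 \<in> T1" "w0 \<in> T2" "g1 w0 = g2 w0" and w: "w \<in> T1" "w \<in> T2"
  shows "g1 w = g2 w"
proof -
  define T where "T = T1 \<inter> T2"
  have T: "open T" "convex T"
    using g by (auto simp: T_def convex_section_def intro: convex_Int)
  have cont: "continuous_on T g1" "continuous_on T g2"
    using g unfolding T_def convex_section_def
    by (auto intro: holomorphic_on_imp_continuous_on holomorphic_on_subset)
  let ?E = "{w \<in> T. g1 w - g2 w = 0}"
  have "closedin (top_of_set T) ?E"
    by (intro continuous_closedin_preimage_constant continuous_intros cont)
  moreover have "open ?E"
    unfolding open_dist
  proof
    fix x assume x: "x \<in> ?E"
    then have xT: "x \<in> T" and gx: "g1 x = g2 x" by auto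
    have "g1 x \<in> U" using g xT by (auto simp: T_def convex_section_def)
    then obtain r where r: "r > 0" "ball (g1 x) r \<subseteq> U" "inj_on f (ball (g1 x) r)"
      using has_complex_derivative_locally_injective[of f U "g1 x"] f by metis
    have "\<forall>\<^sub>F y in at x. y \<in> T" using T xT eventually_at_in_open' by blast
    moreover have "\<forall>\<^sub>F y in at x. dist (g1 y) (g1 x) < r" "\<forall>\<^sub>F y in at x. dist (g2 y) (g2 x) < r"
      using cont T xT r(1) unfolding continuous_on_eq_continuous_at[OF T(1)] continuous_at
      by (auto simp: tendsto_iff)
    ultimately have "\<forall>\<^sub>F y in at x. y \<in> ?E"
    proof eventually_elim
      case (elim y)
      then have "f (g1 y) = f (g2 y)" using g by (auto simp: T_def convex_section_def)
      then show ?case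
        using inj_onD[OF r(3)] elim gx by (auto simp: dist_commute)
    qed
    then obtain e where "e > 0" "\<And>y. y \<noteq> x \<Longrightarrow> dist y x < e \<Longrightarrow> y \<in> ?E"
      unfolding eventually_at by blast
    with x show "\<exists>e>0. \<forall>y. dist y x < e \<longrightarrow> y \<in> ?E" by metis
  qed
  then have "openin (top_of_set T) ?E"
    by (intro open_subset) auto
  moreover have "w0 \<in> ?E" using w0 by (simp add: T_def)
  ultimately have "?E = T"
    using convex_connected[OF T(2)] unfolding connected_clopen by blast
  then show ?thesis using w by (auto simp: T_def)
qed

text \<open>
  The branch of the inverse near \<open>x\<close> also serves all points near \<open>x\<close>, on discs of half the radius, so
  finitely many branches suffice for a compact set.
\<close>
lemma uniform_local_sections:
  assumes f: "f holomorphic_on U" "open U" "\<forall>z\<in>U. deriv f z \<noteq> 0"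
    and K: "compact K" "K \<subseteq> U"
  obtains \<eta> where "\<eta> > 0" "\<And>z. z \<in> K \<Longrightarrow> \<exists>h. convex_section f U (ball (f z) \<eta>) h \<and> h (f z) = z"
proof -
  define good where "good = (\<lambda>z e. \<exists>h. convex_section f U (ball (f z) e) h \<and> h (f z) = z)"
  have good_mono: "good z e'" if "good z e" "e' \<le> e" for z e e'
    using that unfolding good_def by (meson convex_section_subset subset_ball open_ball convex_ball)
  have "\<exists>V e. open V \<and> x \<in> V \<and> e > 0 \<and> (\<forall>z\<in>V. good z e)" if xU: "x \<in> U" for x
  proof -
    obtain r where r: "r > 0" "ball x r \<subseteq> U" "open (f ` ball x r)" "inj_on f (ball x r)"
      using has_complex_derivative_locally_invertible[of f U x] f xU by metis
    have hol: "f holomorphic_on ball x r" using f r holomorphic_on_subset by blast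
    obtain h where h: "h holomorphic_on f ` ball x r" "\<And>z. z \<in> ball x r \<Longrightarrow> h (f z) = z"
      using holomorphic_has_inverse[OF hol open_ball r(4)] by metis
    have "f x \<in> f ` ball x r" using r by simp
    then obtain e where e: "e > 0" "ball (f x) e \<subseteq> f ` ball x r"
      using r(3) open_contains_ball by blast
    let ?V = "ball x r \<inter> f -` ball (f x) (e/2)"
    have "good z (e/2)" if "z \<in> ?V" for z
    proof -
      have "ball (f z) (e/2) \<subseteq> ball (f x) e"
      proof
        fix y assume "y \<in> ball (f z) (e/2)"
        then have "dist (f z) y < e/2" "dist (f x) (f z) < e/2" using that by auto
        then show "y \<in> ball (f x) e" using dist_triangle[of "f x" y "f z"] by simp
      qed
      then have "ball (f z) (e/2) \<subseteq> f ` ball x r" using e by blast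
      moreover have "h ` (f ` ball x r) \<subseteq> U" "\<forall>w\<in>f ` ball x r. f (h w) = w"
        using h(2) r(2) by auto
      ultimately have "convex_section f U (ball (f z) (e/2)) h"
        unfolding convex_section_def using holomorphic_on_subset[OF h(1)]
        by (metis convex_ball image_mono open_ball order_trans subsetD)
      then show ?thesis using h(2) that unfolding good_def by blast
    qed
    moreover have "open ?V"
      using hol by (intro continuous_open_preimage holomorphic_on_imp_continuous_on) auto
    ultimately show ?thesis using e r by (intro exI[of _ ?V] exI[of _ "e/2"]) auto
  qed
  then obtain V e where Ve: "\<And>x. x \<in> U \<Longrightarrow> open (V x)" "\<And>x. x \<in> U \<Longrightarrow> x \<in> V x"
    "\<And>x. x \<in> U \<Longrightarrow> e x > (0::real)" "\<And>x z. x \<in> U \<Longrightarrow> z \<in> V x \<Longrightarrow> good z (e x)"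
    by metis
  obtain C where C: "C \<subseteq> K" "finite C" "K \<subseteq> (\<Union>x\<in>C. V x)"
    using compactE_image[OF K(1), of K V] Ve K(2) by (metis (no_types, lifting) UN_I subsetD subsetI)
  \<comment> \<open>The number 1 is a value in case \<open>C\<close> is empty.\<close>
  define \<eta> where "\<eta> = Min (insert 1 (e ` C))"
  have "\<eta> > 0" using C Ve(3) K by (auto simp: \<eta>_def)
  moreover have "good z \<eta>" if z: "z \<in> K" for z
  proof -
    obtain x where x: "x \<in> C" "z \<in> V x" using C z by blast
    then have "\<eta> \<le> e x" using C by (simp add: \<eta>_def)
    then show ?thesis using good_mono Ve(4) x C K by blast
  qed
  ultimately show ?thesis using that unfolding good_def by blast
qed

text \<open>
  Discs of one radius \<open>\<eta>\<close> centred on a segment cover a convex neighbourhood of the segment.  The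
  branches on two overlapping discs agree: the midpoint of the centres lies in both discs and on the
  segment, where each branch coincides with \<open>g\<close>.
\<close>
lemma convex_section_thicken_segment:
  assumes f: "f holomorphic_on U" "open U" "\<forall>z\<in>U. deriv f z \<noteq> 0"
    and g: "convex_section f U T g" and uv: "closed_segment u v \<subseteq> T"
    and \<eta>: "\<eta> > 0"
      "\<And>p. p \<in> closed_segment u v \<Longrightarrow> \<exists>h. convex_section f U (ball p \<eta>) h \<and> h p = g p"
  obtains h where "convex_section f U (\<Union>p\<in>closed_segment u v. ball p \<eta>) h"
    "\<And>p. p \<in> closed_segment u v \<Longrightarrow> h p = g p"
proof -
  let ?s = "closed_segment u v"
  note unique = convex_section_unique[OF f]
  obtain H where H: "\<And>p. p \<in> ?s \<Longrightarrow> convex_section f U (ball p \<eta>) (H p)"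
    "\<And>p. p \<in> ?s \<Longrightarrow> H p p = g p"
    using \<eta>(2) by metis
  have Hg: "H p x = g x" if "p \<in> ?s" "x \<in> ?s" "x \<in> ball p \<eta>" for p x
    by (rule unique[OF H(1) g, of p p x]) (use that H(2) uv \<eta>(1) in auto)
  have HH: "H p x = H q x" if "p \<in> ?s" "q \<in> ?s" "x \<in> ball p \<eta>" "x \<in> ball q \<eta>" for p q x
  proof -
    let ?m = "midpoint p q"
    have "dist p q < 2 * \<eta>"
      using dist_triangle[of p q x] that by (simp add: dist_commute)
    then have m: "?m \<in> ball p \<eta>" "?m \<in> ball q \<eta>" by (auto simp: dist_midpoint)
    have ms: "?m \<in> ?s"
      using that(1,2) by (meson convex_closed_segment convex_contains_segment midpoint_in_closed_segment subsetD)
    show ?thesis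
      by (rule unique[OF H(1) H(1), of p q ?m x]) (use that m ms Hg in auto)
  qed
  define W where "W = (\<Union>p\<in>?s. ball p \<eta>)"
  define h where "h = (\<lambda>x. H (SOME p. p \<in> ?s \<and> x \<in> ball p \<eta>) x)"
  have hH: "h x = H p x" if "p \<in> ?s" "x \<in> ball p \<eta>" for p x
  proof -
    have "(SOME p. p \<in> ?s \<and> x \<in> ball p \<eta>) \<in> ?s \<and> x \<in> ball (SOME p. p \<in> ?s \<and> x \<in> ball p \<eta>) \<eta>"
      by (rule someI[of _ p]) (use that in blast)
    then show ?thesis unfolding h_def using HH that by blast
  qed
  have "convex W"
  proof -
    have "W = (\<Union>x\<in>?s. \<Union>y\<in>ball 0 \<eta>. {x + y})"
    proof (intro equalityI subsetI)
      fix x assume "x \<in> W"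
      then obtain p where "p \<in> ?s" "x - p \<in> ball 0 \<eta>"
        by (auto simp: W_def dist_norm norm_minus_commute)
      then show "x \<in> (\<Union>x\<in>?s. \<Union>y\<in>ball 0 \<eta>. {x + y})"
        by (intro UN_I[of p] UN_I[of "x - p"]) auto
    next
      fix x assume "x \<in> (\<Union>x\<in>?s. \<Union>y\<in>ball 0 \<eta>. {x + y})"
      then obtain p y where "p \<in> ?s" "norm y < \<eta>" "x = p + y" by auto
      then show "x \<in> W"
        unfolding W_def by (intro UN_I[of p]) (auto simp: dist_norm)
    qed
    then show ?thesis by (simp add: convex_sums)
  qed
  moreover have "h holomorphic_on W"
    unfolding W_def
  proof (rule holomorphic_on_UN_open)
    fix p assume p: "p \<in> ?s"
    then show "h holomorphic_on ball p \<eta>"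
      using H(1)[OF p] hH[OF p] unfolding convex_section_def by (metis holomorphic_transform)
  qed auto
  moreover have "h ` W \<subseteq> U \<and> (\<forall>w\<in>W. f (h w) = w)"
    using H(1) hH unfolding convex_section_def W_def by (auto simp: image_subset_iff)
  moreover have "open W" unfolding W_def by auto
  ultimately have "convex_section f U W h" unfolding convex_section_def by blast
  moreover have "h p = g p" if "p \<in> ?s" for p
    using hH[OF that, of p] H(2)[OF that] \<eta>(1) by simp
  ultimately show ?thesis using that unfolding W_def by blast
qed

section \<open>Convexity of the image from the curvature condition\<close>

text \<open>An interior maximum would be a critical point, just after which the function increases.\<close>
lemma le_max_endpoints_if_critical_points_are_minima:
  fixes N N' N'' :: "real \<Rightarrow> real"
  assumes N: "\<And>t. t \<in> {0..1} \<Longrightarrow> (N has_real_derivative N' t) (at t)"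
    and N': "\<And>t. t \<in> {0..1} \<Longrightarrow> (N' has_real_derivative N'' t) (at t)"
    and crit: "\<And>t. t \<in> {0..1} \<Longrightarrow> N' t = 0 \<Longrightarrow> N'' t > 0"
    and t: "t \<in> {0..1}"
  shows "N t \<le> max (N 0) (N 1)"
proof -
  have "continuous_on {0..1} N"
    using N by (meson DERIV_isCont continuous_at_imp_continuous_on)
  then obtain m where m: "m \<in> {0..1}" "\<And>s. s \<in> {0..1} \<Longrightarrow> N s \<le> N m"
    using continuous_attains_sup[of "{0..1}" N] by fastforce
  show ?thesis
  proof (cases "m = 0 \<or> m = 1")
    case True
    then show ?thesis using m(2)[OF t] by auto
  next
    case False
    then have m01: "0 < m" "m < 1" using m(1) by auto
    have "N' m = 0"
      by (rule DERIV_local_max[OF N[OF m(1)], of "min m (1 - m)"])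
        (use m01 in \<open>auto intro!: m(2) simp: abs_less_iff\<close>)
    then obtain d where d: "d > 0" "\<And>h. 0 < h \<Longrightarrow> h < d \<Longrightarrow> N' (m + h) > 0"
      using DERIV_pos_inc_right[OF N'[OF m(1)] crit[OF m(1)]] by auto
    define b where "b = min (m + d / 2) 1"
    have b: "m < b" "b \<le> 1" "b < m + d" using d m01 by (auto simp: b_def)
    obtain z where z: "m < z" "z < b" "N b - N m = (b - m) * N' z"
      using MVT2[OF b(1), of N N'] N m01 b by auto
    then have "N' z > 0" using d(2)[of "z - m"] b by simp
    then have "N b > N m" using z b using mult_pos_pos[of "b - m" "N' z"] by linarith
    then show ?thesis using m(2)[of b] b m01 by simp
  qed
qed

text \<open>
  Let a curve \<open>\<gamma>\<close> be mapped by \<open>f\<close> to a segment run through at constant speed, with \<open>z = \<gamma> t\<close> and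
  \<open>p = \<gamma>' t\<close>.  Then \<open>\<gamma>'' t = - p\<^sup>2 s\<close> for \<open>s = f'' z / f' z\<close>, and the expression below is half the
  second derivative of \<open>\<bar>\<gamma>\<bar>\<^sup>2\<close>.  If \<open>\<gamma>\<close> is tangential to the circle around 0 at \<open>t\<close>, then
  \<open>p = \<i> \<kappa> z\<close> with \<open>\<kappa>\<close> real, and the expression is \<open>\<kappa>\<^sup>2 \<bar>z\<bar>\<^sup>2 Re (1 + z s)\<close>.
\<close>
lemma acceleration_positive_if_tangential:
  fixes z p s :: complex
  assumes zp: "inner z p = 0" and "p \<noteq> 0" and s: "Re (1 + z * s) > 0"
  shows "inner p p - inner z (p\<^sup>2 * s) > 0"
proof (cases "z = 0")
  case True
  then show ?thesis using assms by simp
next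
  case False
  define m where "m = Im (cnj z * p)"
  define \<kappa> where "\<kappa> = m / (norm z)\<^sup>2"
  have inner_mult: "inner z (z * w) = (norm z)\<^sup>2 * Re w" for w :: complex
    unfolding inner_complex_def by (simp add: cmod_power2) (simp add: algebra_simps power2_eq_square)
  have "cnj z * p = \<i> * of_real m"
    using zp by (simp add: complex_eq_iff inner_complex_def m_def)
  then have "z * cnj z * p = z * (\<i> * of_real m)" by (simp add: mult.assoc)
  then have "of_real ((norm z)\<^sup>2) * p = z * (\<i> * of_real m)"
    by (simp only: complex_norm_square)
  then have p: "p = of_real \<kappa> * \<i> * z"
    using False by (simp add: \<kappa>_def field_simps)
  then have "\<kappa> \<noteq> 0" using \<open>p \<noteq> 0\<close> by auto
  have "inner p p = \<kappa>\<^sup>2 * (norm z)\<^sup>2"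
    by (simp add: p dot_square_norm norm_mult power_mult_distrib)
  moreover have "p\<^sup>2 * s = z * (of_real (- (\<kappa>\<^sup>2)) * (z * s))"
    by (simp add: p power_mult_distrib) (simp add: power2_eq_square mult_ac)
  then have "inner z (p\<^sup>2 * s) = - (\<kappa>\<^sup>2 * (norm z)\<^sup>2 * Re (z * s))"
    by (simp only: inner_mult) simp
  ultimately have "inner p p - inner z (p\<^sup>2 * s) = \<kappa>\<^sup>2 * (norm z)\<^sup>2 * Re (1 + z * s)"
    by (simp add: algebra_simps)
  then show ?thesis using s \<open>\<kappa> \<noteq> 0\<close> False by simp
qed

text \<open>
  The modulus along the preimage of a segment has only strict minima as critical points, so this
  preimage cannot leave the smallest disc around 0 that contains its endpoints.
\<close>
lemma convex_section_norm_le: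
  assumes f: "f holomorphic_on ball 0 1" "\<forall>z\<in>ball 0 1. deriv f z \<noteq> 0"
    and curv: "\<forall>z\<in>ball 0 1. Re (1 + z * (deriv (deriv f) z / deriv f z)) > 0"
    and g: "convex_section f (ball 0 1) T g" and uv: "u \<in> T" "v \<in> T" "p \<in> closed_segment u v"
  shows "norm (g p) \<le> max (norm (g u)) (norm (g v))"
proof (cases "u = v")
  case False
  define d where "d = v - u"
  define l where "l = (\<lambda>t. u + of_real t * d)"
  define q where "q = (\<lambda>z. d / deriv f z)"
  define q' where "q' = (\<lambda>z. - ((d / deriv f z) * (deriv (deriv f) z / deriv f z)))"
  define N where "N = (\<lambda>t. inner (g (l t)) (g (l t)))"
  define N' where "N' = (\<lambda>t. 2 * inner (g (l t)) (q (g (l t))))"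
  define N'' where "N'' = (\<lambda>t. 2 * (inner (g (l t)) (q (g (l t)) * q' (g (l t))) + inner (q (g (l t))) (q (g (l t)))))"
  have T: "open T" "convex T" "g holomorphic_on T" "g ` T \<subseteq> ball 0 1" "\<And>w. w \<in> T \<Longrightarrow> f (g w) = w"
    using g by (auto simp: convex_section_def)
  have l_eq: "l t = (1 - t) *\<^sub>R u + t *\<^sub>R v" for t
    by (simp add: l_def d_def scaleR_conv_of_real algebra_simps)
  have lT: "l t \<in> T" if "t \<in> {0..1}" for t
    unfolding l_eq using T(2) uv that by (auto intro!: convexD_alt)
  have glD: "g (l t) \<in> ball 0 1" if "t \<in> {0..1}" for t using lT[OF that] T(4) by blast
  have g': "(g has_field_derivative 1 / deriv f (g w)) (at w)" if w: "w \<in> T" for w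
  proof -
    have gw: "g w \<in> ball 0 1" using T(4) w by blast
    have 1: "(g has_field_derivative deriv g w) (at w)"
      by (rule holomorphic_derivI[OF T(3,1) w])
    moreover have "(f has_field_derivative deriv f (g w)) (at (g w))"
      using f(1) gw by (intro holomorphic_derivI[of f "ball 0 1"]) auto
    ultimately have "((\<lambda>w. f (g w)) has_field_derivative deriv f (g w) * deriv g w) (at w)"
      by (rule DERIV_chain2[rotated])
    then have "((\<lambda>w. w) has_field_derivative deriv f (g w) * deriv g w) (at w)"
      by (rule has_field_derivative_transform_within_open[OF _ T(1) w]) (use T(5) in auto)
    then have "deriv f (g w) * deriv g w = 1"
      using DERIV_unique DERIV_ident by blast
    then have "deriv g w = 1 / deriv f (g w)"
      using f(2) gw by (simp add: field_simps)
    with 1 show ?thesis by simp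
  qed
  have \<gamma>': "((\<lambda>t. g (l t)) has_vector_derivative q (g (l t))) (at t)" if "t \<in> {0..1}" for t
  proof -
    have "(l has_vector_derivative d) (at t)"
      unfolding l_def by (auto intro!: derivative_eq_intros simp: has_vector_derivative_def scaleR_conv_of_real)
    from field_vector_diff_chain_at[OF this g'[OF lT[OF that]]]
    show ?thesis by (simp add: q_def o_def)
  qed
  have q: "(q has_field_derivative q' z) (at z)" if "z \<in> ball 0 1" for z
  proof -
    have "(deriv f has_field_derivative deriv (deriv f) z) (at z)"
      using f(1) that by (intro holomorphic_derivI[of "deriv f" "ball 0 1"] holomorphic_deriv) auto
    then have "(q has_field_derivative (0 * deriv f z - d * deriv (deriv f) z) / (deriv f z * deriv f z)) (at z)"
      unfolding q_def using f(2) that by (intro DERIV_divide DERIV_const) auto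
    then show ?thesis by (simp add: q'_def)
  qed
  have q\<gamma>': "((\<lambda>t. q (g (l t))) has_vector_derivative q (g (l t)) * q' (g (l t))) (at t)"
    if "t \<in> {0..1}" for t
    using field_vector_diff_chain_at[OF \<gamma>'[OF that] q[OF glD[OF that]]] by (simp add: o_def)
  have N: "(N has_real_derivative N' t) (at t)" if "t \<in> {0..1}" for t
    unfolding N_def N'_def has_real_derivative_iff_has_vector_derivative
    using bounded_bilinear.has_vector_derivative[OF bounded_bilinear_inner \<gamma>'[OF that] \<gamma>'[OF that]]
    by (simp add: inner_commute)
  have N': "(N' has_real_derivative N'' t) (at t)" if "t \<in> {0..1}" for t
    unfolding N'_def N''_def
    by (intro DERIV_cmult)
      (use bounded_bilinear.has_vector_derivative[OF bounded_bilinear_inner \<gamma>'[OF that] q\<gamma>'[OF that]]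
        in \<open>simp add: has_real_derivative_iff_has_vector_derivative\<close>)
  have crit: "N'' t > 0" if "t \<in> {0..1}" "N' t = 0" for t
  proof -
    let ?z = "g (l t)" and ?s = "deriv (deriv f) (g (l t)) / deriv f (g (l t))"
    have "q ?z \<noteq> 0" using False f(2) glD[OF that(1)] by (simp add: q_def d_def)
    moreover have "inner ?z (q ?z) = 0" using that by (simp add: N'_def)
    ultimately have "inner (q ?z) (q ?z) - inner ?z ((q ?z)\<^sup>2 * ?s) > 0"
      using curv glD[OF that(1)] by (intro acceleration_positive_if_tangential) auto
    moreover have "q ?z * q' ?z = - ((q ?z)\<^sup>2 * ?s)"
      by (simp only: q_def q'_def power2_eq_square mult_minus_right mult.assoc)
    ultimately show ?thesis by (simp add: N''_def)
  qed
  obtain t where t: "t \<in> {0..1}" "p = l t"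
    using uv(3) by (auto simp: in_segment l_eq)
  have "N t \<le> max (N 0) (N 1)"
    using le_max_endpoints_if_critical_points_are_minima[OF N N' crit t(1)] .
  then have "(norm (g p))\<^sup>2 \<le> max ((norm (g u))\<^sup>2) ((norm (g v))\<^sup>2)"
    by (simp add: N_def t(2) dot_square_norm) (simp add: l_def d_def)
  then show ?thesis
    by (auto simp: le_max_iff_disj)
qed (use uv in simp)

text \<open>
  For fixed \<open>a\<close>, the set \<open>B\<close> of all \<open>b\<close> that can be reached from \<open>a\<close> by a branch is open.  It is also
  closed in the disc: if points \<open>b\<close> of \<open>B\<close> approach \<open>z\<close>, the preimages of the segments from \<open>f a\<close> to
  \<open>f b\<close> stay in one compact disc by the previous lemma, so branches exist on tubes of fixed width
  around these segments, and such a tube eventually contains \<open>f z\<close>.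
\<close>
lemma convex_section_between:
  assumes f: "f holomorphic_on ball 0 1" "\<forall>z\<in>ball 0 1. deriv f z \<noteq> 0"
    and curv: "\<forall>z\<in>ball 0 1. Re (1 + z * (deriv (deriv f) z / deriv f z)) > 0"
    and a: "a \<in> ball 0 1" and b: "b \<in> ball 0 1"
  shows "\<exists>T g. convex_section f (ball 0 1) T g \<and> f a \<in> T \<and> f b \<in> T \<and> g (f a) = a \<and> g (f b) = b"
proof -
  let ?D = "ball 0 1 :: complex set"
  note unique = convex_section_unique[OF f(1) open_ball f(2)]
  define B where "B = {b \<in> ?D. \<exists>T g. convex_section f ?D T g \<and> f a \<in> T \<and> f b \<in> T \<and> g (f a) = a \<and> g (f b) = b}"
  have "a \<in> B"
  proof -
    obtain \<eta> where "\<eta> > 0" "\<exists>h. convex_section f ?D (ball (f a) \<eta>) h \<and> h (f a) = a"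
      using uniform_local_sections[OF f(1) open_ball f(2), of "{a}"] a by auto
    then show ?thesis using a unfolding B_def by force
  qed
  have "open B"
    unfolding open_subopen[of B]
  proof
    fix b assume "b \<in> B"
    then obtain T g where g: "convex_section f ?D T g" "f a \<in> T" "f b \<in> T" "g (f a) = a" "g (f b) = b"
      by (auto simp: B_def)
    then have "open T" "g holomorphic_on T" "\<And>w. w \<in> T \<Longrightarrow> f (g w) = w" "g ` T \<subseteq> ?D"
      by (auto simp: convex_section_def)
    moreover from this have "inj_on g T" by (metis inj_onI)
    ultimately have "open (g ` T)"
      by (intro invariance_of_domain holomorphic_on_imp_continuous_on)
    moreover have "g w \<in> B" if "w \<in> T" for w
    proof -
      have "g w \<in> ?D" "f (g w) = w" using g(1) that by (auto simp: convex_section_def)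
      then show ?thesis
        unfolding B_def using g that by (intro CollectI conjI exI[of _ T] exI[of _ g]) auto
    qed
    then have "g ` T \<subseteq> B" by blast
    ultimately show "\<exists>V. open V \<and> b \<in> V \<and> V \<subseteq> B" using g by (metis imageI)
  qed
  have "z \<in> B" if z: "z \<in> ?D" "z \<in> closure B" for z
  proof -
    \<comment> \<open>The radius exceeds \<open>\<bar>z\<bar>\<close>, so it also bounds the points of \<open>B\<close> near \<open>z\<close>.\<close>
    define R where "R = max (norm a) ((1 + norm z) / 2)"
    have R: "norm z < R" "norm a \<le> R" "R < 1" using a z by (auto simp: R_def less_max_iff_disj)
    then have "cball 0 R \<subseteq> ?D" by auto
    then obtain \<eta> where \<eta>: "\<eta> > 0"
      "\<And>z. z \<in> cball 0 R \<Longrightarrow> \<exists>h. convex_section f ?D (ball (f z) \<eta>) h \<and> h (f z) = z"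
      using uniform_local_sections[OF f(1) open_ball f(2) compact_cball] by blast
    obtain h0 where h0: "convex_section f ?D (ball (f z) \<eta>) h0" "h0 (f z) = z"
      using \<eta>(2)[of z] R by auto
    then have h0': "h0 holomorphic_on ball (f z) \<eta>" "\<And>w. w \<in> ball (f z) \<eta> \<Longrightarrow> f (h0 w) = w"
      by (auto simp: convex_section_def)
    have "open (h0 ` ball (f z) \<eta>)"
      by (intro invariance_of_domain holomorphic_on_imp_continuous_on h0' open_ball)
        (use h0'(2) in \<open>metis inj_onI\<close>)
    then have "open (h0 ` ball (f z) \<eta> \<inter> ball 0 R)" by auto
    moreover have "z \<in> h0 ` ball (f z) \<eta> \<inter> ball 0 R"
      using h0(2) \<eta>(1) R by (auto intro!: image_eqI[of _ _ "f z"])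
    ultimately have "h0 ` ball (f z) \<eta> \<inter> ball 0 R \<inter> B \<noteq> {}"
      using z(2) by (metis IntI empty_iff open_Int_closure_eq_empty)
    then obtain b where b: "b \<in> B" "b \<in> h0 ` ball (f z) \<eta>" "norm b < R"
      unfolding ex_in_conv[symmetric] by (metis IntE mem_ball_0)
    then have fb: "f b \<in> ball (f z) \<eta>" "h0 (f b) = b" using h0'(2) by auto
    obtain T g where g: "convex_section f ?D T g" "f a \<in> T" "f b \<in> T" "g (f a) = a" "g (f b) = b"
      using b(1) by (auto simp: B_def)
    let ?s = "closed_segment (f a) (f b)"
    have sT: "?s \<subseteq> T"
      using g by (intro closed_segment_subset) (auto simp: convex_section_def)
    have "\<exists>h. convex_section f ?D (ball p \<eta>) h \<and> h p = g p" if p: "p \<in> ?s" for p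
    proof -
      have "norm (g p) \<le> R"
        using convex_section_norm_le[OF f curv g(1-3) p] g R b by simp
      moreover have "f (g p) = p" using g(1) sT p by (auto simp: convex_section_def)
      ultimately show ?thesis using \<eta>(2)[of "g p"] by simp
    qed
    then obtain h where h: "convex_section f ?D (\<Union>p\<in>?s. ball p \<eta>) h" "\<And>p. p \<in> ?s \<Longrightarrow> h p = g p"
      using convex_section_thicken_segment[OF f(1) open_ball f(2) g(1) sT \<eta>(1)] by metis
    have mem: "f a \<in> (\<Union>p\<in>?s. ball p \<eta>)" "f b \<in> (\<Union>p\<in>?s. ball p \<eta>)" "f z \<in> (\<Union>p\<in>?s. ball p \<eta>)"
      using \<eta>(1) fb(1) ends_in_segment[of "f a" "f b"]
      by (auto simp: dist_commute intro: bexI[of _ "f a"] bexI[of _ "f b"])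
    have "h (f z) = h0 (f z)"
      by (rule unique[OF h(1) h0(1), of "f b"]) (use mem fb h(2) g \<eta>(1) in auto)
    then have "h (f z) = z" "h (f a) = a" using h0 h(2) g by auto
    then show ?thesis using h(1) mem z(1) unfolding B_def by blast
  qed
  then have "B = ?D \<inter> closure B" using closure_subset[of B] by (auto simp: B_def)
  then have "closedin (top_of_set ?D) B" unfolding closedin_closed using closed_closure by blast
  moreover have "openin (top_of_set ?D) B"
    using \<open>open B\<close> by (intro open_subset) (auto simp: B_def)
  ultimately have "B = ?D"
    using connected_ball[of 0 "1::real"] \<open>a \<in> B\<close> unfolding connected_clopen by blast
  then show ?thesis using b unfolding B_def by blast
qed

text \<open>
  A branch sends the segment between two image points back into the disc, so that the segment lies in
  the image; if the two points coincide, so do their preimages under the branch.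
\<close>
lemma convex_univalent_criterion:
  assumes f: "f holomorphic_on ball 0 1" "\<forall>z\<in>ball 0 1. deriv f z \<noteq> 0"
    and curv: "\<forall>z\<in>ball 0 1. Re (1 + z * (deriv (deriv f) z / deriv f z)) > 0"
  shows "inj_on f (ball 0 1)" "convex (f ` ball 0 1)"
proof -
  note between = convex_section_between[OF assms]
  show "inj_on f (ball 0 1)"
    by (rule inj_onI) (metis between)
  show "convex (f ` ball 0 1)"
    unfolding convex_contains_segment
  proof (intro ballI)
    fix u v assume "u \<in> f ` ball 0 1" "v \<in> f ` ball 0 1"
    then obtain T g where g: "convex_section f (ball 0 1) T g" "u \<in> T" "v \<in> T"
      using between by blast
    then have "closed_segment u v \<subseteq> T"
      by (intro closed_segment_subset) (auto simp: convex_section_def)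
    then show "closed_segment u v \<subseteq> f ` ball 0 1"
      using g(1) unfolding convex_section_def by (metis (no_types, lifting) image_eqI image_subset_iff subset_iff)
  qed
qed

section \<open>Images of convex domains under strongly monotone maps\<close>

text \<open>
  The half-lines start at the images of boundary points \<open>q\<close> and run in the directions of the outer
  normals at \<open>q\<close>; a corner contributes a whole fan of normals.
\<close>
lemma strongly_monotone_image_close_to_convex:
  fixes \<Phi> :: "complex \<Rightarrow> complex"
  assumes "open \<Omega>" "convex \<Omega>" "\<Omega> \<noteq> {}"
    and lip: "L-lipschitz_on \<Omega> \<Phi>"
    and k: "k > 0"
    and mono: "\<And>u v. u \<in> \<Omega> \<Longrightarrow> v \<in> \<Omega> \<Longrightarrow> k * (norm (u - v))\<^sup>2 \<le> inner (\<Phi> u - \<Phi> v) (u - v)"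
  shows "close_to_convex_domain (\<Phi> ` \<Omega>)"
proof -
  define S where "S = closure \<Omega>"
  have S: "closed S" "convex S" "S \<noteq> {}" "\<Omega> \<subseteq> S"
    using assms closure_subset by (auto simp: S_def intro: convex_closure)
  have int_S: "interior S = \<Omega>"
    using assms by (simp add: S_def convex_interior_closure interior_open)
  obtain E where E_lip: "L-lipschitz_on S E" and E: "\<And>u. u \<in> \<Omega> \<Longrightarrow> E u = \<Phi> u"
    using lipschitz_extend_closure[OF lip] unfolding S_def by blast
  have contE: "continuous_on S E"
    by (rule lipschitz_on_continuous_on[OF E_lip])
  have E_mono: "k * (norm (u - v))\<^sup>2 \<le> inner (E u - E v) (u - v)" if "u \<in> S" "v \<in> S" for u v
  proof -
    define D where "D = (\<lambda>(u, v). k * (norm (u - v))\<^sup>2 - inner (E u - E v) (u - v))"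
    have "continuous_on (S \<times> S) (\<lambda>p. E (fst p))" "continuous_on (S \<times> S) (\<lambda>p. E (snd p))"
      by (auto intro!: continuous_on_compose2[OF contE] continuous_intros)
    then have "continuous_on (closure (\<Omega> \<times> \<Omega>)) D"
      unfolding D_def case_prod_unfold closure_Times S_def[symmetric]
      by (intro continuous_intros)
    then have "D (u, v) \<le> 0"
      by (rule continuous_le_on_closure)
        (use that mono in \<open>auto simp: D_def E closure_Times S_def\<close>)
    then show ?thesis by (simp add: D_def)
  qed

  define P where "P = closest_point S"
  have P_in: "P u \<in> S" for u
    unfolding P_def using S by (intro closest_point_in_set) auto
  have P_id: "P u = u" if "u \<in> S" for u
    unfolding P_def using that by (rule closest_point_self)
  have P_dot: "inner (u - P u) (y - P u) \<le> 0" if "y \<in> S" for u y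
    unfolding P_def using S that by (intro closest_point_dot) auto
  define \<Psi> where "\<Psi> = (\<lambda>u. E (P u) + (u - P u))"
  have cont\<Psi>: "continuous_on UNIV \<Psi>"
  proof -
    have "continuous_on UNIV P"
      unfolding P_def using S by (intro continuous_on_closest_point) auto
    moreover from this have "continuous_on UNIV (\<lambda>u. E (P u))"
      by (rule continuous_on_compose2[OF contE]) (use P_in in auto)
    ultimately show ?thesis
      unfolding \<Psi>_def by (intro continuous_intros)
  qed
  \<comment> \<open>The projection is monotone in the sense that \<open>(u - P u) - (v - P v)\<close> and \<open>P u - P v\<close> form no obtuse
    angle, so adding \<open>u - P u\<close> does not spoil the monotonicity of \<open>E\<close>.\<close>
  have \<Psi>_P: "k * norm (P u - P v) \<le> norm (\<Psi> u - \<Psi> v)" for u v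
  proof (cases "P u = P v")
    case False
    let ?a = "u - P u" and ?b = "v - P v"
    have "inner ?a (P v - P u) \<le> 0" "inner ?b (P u - P v) \<le> 0"
      using P_dot P_in by auto
    then have "0 \<le> inner (?a - ?b) (P u - P v)"
      by (simp add: inner_diff_left inner_diff_right)
    moreover have "k * (norm (P u - P v))\<^sup>2 \<le> inner (E (P u) - E (P v)) (P u - P v)"
      using E_mono P_in by auto
    ultimately have "k * (norm (P u - P v))\<^sup>2 \<le> inner (\<Psi> u - \<Psi> v) (P u - P v)"
      by (simp add: \<Psi>_def inner_diff_left inner_add_left)
    also have "\<dots> \<le> norm (\<Psi> u - \<Psi> v) * norm (P u - P v)"
      by (rule norm_cauchy_schwarz)
    finally show ?thesis
      using False by (simp add: power2_eq_square)
  qed simp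
  \<comment> \<open>The inverse of \<open>\<Psi>\<close> is Lipschitz, which yields injectivity and a closed range.\<close>
  have \<Psi>_expand: "k * norm (u - v) \<le> (k + L + 1) * norm (\<Psi> u - \<Psi> v)" for u v
  proof -
    have "norm (E (P u) - E (P v)) \<le> L * norm (P u - P v)"
      using lipschitz_onD[OF E_lip P_in P_in] by (simp add: dist_norm)
    moreover have "u - v = (\<Psi> u - \<Psi> v) - (E (P u) - E (P v)) + (P u - P v)"
      by (simp add: \<Psi>_def)
    ultimately have "norm (u - v) \<le> norm (\<Psi> u - \<Psi> v) + L * norm (P u - P v) + norm (P u - P v)"
      by (smt (verit) norm_triangle_ineq norm_triangle_ineq4)
    then have "k * norm (u - v) \<le> k * (norm (\<Psi> u - \<Psi> v) + L * norm (P u - P v) + norm (P u - P v))"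
      using k by simp
    also have "\<dots> = k * norm (\<Psi> u - \<Psi> v) + L * (k * norm (P u - P v)) + k * norm (P u - P v)"
      by (simp add: algebra_simps)
    also have "\<dots> \<le> k * norm (\<Psi> u - \<Psi> v) + L * norm (\<Psi> u - \<Psi> v) + norm (\<Psi> u - \<Psi> v)"
      by (intro add_mono mult_left_mono \<Psi>_P order_refl lipschitz_on_nonneg[OF E_lip])
    finally show ?thesis by (simp add: algebra_simps)
  qed
  have inj\<Psi>: "inj \<Psi>"
  proof (rule injI)
    fix u v assume "\<Psi> u = \<Psi> v"
    then show "u = v" using \<Psi>_expand[of u v] k by (simp add: mult_le_0_iff)
  qed
  have "closed (range \<Psi>)"
    unfolding closed_sequential_limits
  proof (intro allI impI, elim conjE)
    fix x l assume x: "\<forall>n. x n \<in> range \<Psi>" and l: "x \<longlonglongrightarrow> l"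
    then have "\<forall>n. \<exists>u. x n = \<Psi> u" by blast
    then obtain y where y: "\<And>n. x n = \<Psi> (y n)" by metis
    define M where "M = (k + L + 1) / k"
    have M: "M > 0" using k lipschitz_on_nonneg[OF E_lip] by (auto simp: M_def intro!: divide_pos_pos add_nonneg_pos)
    have dM: "dist (y m) (y n) \<le> M * dist (x m) (x n)" for m n
      using \<Psi>_expand[of "y m" "y n"] k by (simp add: M_def field_simps y dist_norm)
    have "Cauchy y"
    proof (rule metric_CauchyI)
      fix e :: real assume "e > 0"
      then have "e / M > 0" using M by simp
      then obtain n0 where "\<forall>m\<ge>n0. \<forall>n\<ge>n0. dist (x m) (x n) < e / M"
        using LIMSEQ_imp_Cauchy[OF l] unfolding Cauchy_def by blast
      then have "\<forall>m\<ge>n0. \<forall>n\<ge>n0. M * dist (x m) (x n) < e"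
        using M by (simp add: pos_less_divide_eq mult.commute)
      then show "\<exists>n0. \<forall>m\<ge>n0. \<forall>n\<ge>n0. dist (y m) (y n) < e"
        using dM le_less_trans by blast
    qed
    then obtain z where "y \<longlonglongrightarrow> z" using Cauchy_convergent convergent_def by blast
    moreover have "isCont \<Psi> z"
      using cont\<Psi> by (simp add: continuous_on_eq_continuous_at)
    ultimately have "(\<lambda>n. \<Psi> (y n)) \<longlonglongrightarrow> \<Psi> z"
      by (rule isCont_tendsto_compose[rotated])
    then have "l = \<Psi> z"
      using l unfolding y[symmetric] by (rule LIMSEQ_unique[rotated])
    then show "l \<in> range \<Psi>" by simp
  qed
  moreover have "open (range \<Psi>)"
    using invariance_of_domain[OF cont\<Psi> open_UNIV inj\<Psi>] .
  ultimately have surj\<Psi>: "range \<Psi> = UNIV"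
    using clopen[of "range \<Psi>"] by auto

  define R where "R = {(E q, n) | q n. q \<in> S - \<Omega> \<and> norm n = 1 \<and> (\<forall>y\<in>S. inner n (y - q) \<le> 0)}"
  have P_ray: "P (q + of_real t * n) = q"
    if "q \<in> S" "\<forall>y\<in>S. inner n (y - q) \<le> 0" "t \<ge> 0" for q n t
    unfolding P_def
  proof (rule closest_point_unique[symmetric])
    show "\<forall>z\<in>S. dist (q + of_real t * n) q \<le> dist (q + of_real t * n) z"
    proof
      fix z assume "z \<in> S"
      with that have "inner n (z - q) \<le> 0" by blast
      then have "inner (t *\<^sub>R n) (z - q) \<le> 0" using that by (simp add: mult_le_0_iff)
      moreover have "inner a a \<le> inner (a - b) (a - b)" if "inner a b \<le> 0" for a b :: complex
        using that inner_ge_zero[of b]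
        by (simp only: inner_diff_left inner_diff_right inner_commute[of b a])
      ultimately have "inner (t *\<^sub>R n) (t *\<^sub>R n) \<le> inner (t *\<^sub>R n - (z - q)) (t *\<^sub>R n - (z - q))"
        by blast
      then have "norm (t *\<^sub>R n) \<le> norm (t *\<^sub>R n - (z - q))"
        by (simp only: norm_le)
      then show "dist (q + of_real t * n) q \<le> dist (q + of_real t * n) z"
        by (simp add: dist_norm scaleR_conv_of_real algebra_simps)
    qed
  qed (use S that in auto)
  then have \<Psi>_ray: "\<Psi> (q + of_real t * n) = E q + of_real t * n"
    if "q \<in> S" "\<forall>y\<in>S. inner n (y - q) \<le> 0" "t \<ge> 0" for q n t
    using that by (simp add: \<Psi>_def)
  have \<Psi>_\<Omega>: "\<Psi> u = \<Phi> u" if "u \<in> \<Omega>" for u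
    using that S P_id[of u] by (auto simp: \<Psi>_def E)
  then have im: "\<Psi> ` \<Omega> = \<Phi> ` \<Omega>" by auto

  have op: "open (\<Phi> ` \<Omega>)"
    unfolding im[symmetric]
    using invariance_of_domain[of \<Omega> \<Psi>] cont\<Psi> inj\<Psi> assms(1)
    by (meson continuous_on_subset inj_on_subset subset_UNIV)
  have conn: "connected (\<Phi> ` \<Omega>)"
    using connected_continuous_image[OF lipschitz_on_continuous_on[OF lip] convex_connected] assms by blast
  have nonzero: "\<forall>(a, d)\<in>R. d \<noteq> 0" by (auto simp: R_def)
  have disj: "open_ray a d \<inter> open_ray b e = {}"
    if ad: "(a, d) \<in> R" and be: "(b, e) \<in> R" and ne: "(a, d) \<noteq> (b, e)" for a d b e
  proof (rule ccontr)
    assume "open_ray a d \<inter> open_ray b e \<noteq> {}"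
    then obtain s t where st: "s > 0" "t > 0" "a + of_real s * d = b + of_real t * e"
      unfolding open_ray_def by auto
    obtain p where p: "a = E p" "p \<in> S" "norm d = 1" "\<forall>y\<in>S. inner d (y - p) \<le> 0"
      using ad by (auto simp: R_def)
    obtain q where q: "b = E q" "q \<in> S" "norm e = 1" "\<forall>y\<in>S. inner e (y - q) \<le> 0"
      using be by (auto simp: R_def)
    have "\<Psi> (p + of_real s * d) = \<Psi> (q + of_real t * e)"
      using st p q \<Psi>_ray by auto
    then have eq: "p + of_real s * d = q + of_real t * e"
      using inj\<Psi> by (simp add: inj_eq)
    then have "p = q" using P_ray p q st by (metis less_eq_real_def)
    with eq have "of_real s * d = of_real t * e" by simp
    moreover from this have "s = t"
      using p q st by (metis abs_of_pos mult.right_neutral norm_mult norm_of_real)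
    ultimately show False using \<open>p = q\<close> ne p q st by auto
  qed
  have compl: "- (\<Phi> ` \<Omega>) = (\<Union>(a, d)\<in>R. closed_ray a d)"
  proof (intro equalityI subsetI)
    fix w assume "w \<in> - (\<Phi> ` \<Omega>)"
    moreover obtain u where u: "w = \<Psi> u" using surj\<Psi> by blast
    ultimately have "u \<notin> \<Omega>" using \<Psi>_\<Omega> by auto
    let ?q = "P u"
    have q: "?q \<in> S - \<Omega>"
    proof -
      have "rel_interior S = \<Omega>" "affine hull S = UNIV"
        using int_S assms(3) rel_interior_nonempty_interior affine_hull_nonempty_interior by metis+
      then show ?thesis
        using closest_point_in_rel_interior[of S u] S \<open>u \<notin> \<Omega>\<close> P_in by (auto simp: P_def)
    qed
    have "\<exists>n t. norm n = 1 \<and> (\<forall>y\<in>S. inner n (y - ?q) \<le> 0) \<and> t \<ge> 0 \<and> u = ?q + of_real t * n"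
    \<comment> \<open>A boundary point \<open>u\<close> is its own projection; a normal there comes from a supporting line.\<close>
    proof (cases "u = ?q")
      case True
      have "rel_interior \<Omega> = \<Omega>" using assms by (simp add: rel_interior_open)
      have "\<exists>a. a \<noteq> 0 \<and> (\<forall>y\<in>S. inner a ?q \<le> inner a y)"
      proof (rule supporting_hyperplane_relative_frontier[OF assms(2), of ?q, folded S_def])
        show "?q \<in> S" "?q \<notin> rel_interior \<Omega>"
          using q \<open>rel_interior \<Omega> = \<Omega>\<close> by auto
      qed blast
      then obtain a where a: "a \<noteq> 0" "\<And>y. y \<in> S \<Longrightarrow> inner a ?q \<le> inner a y"
        by blast
      have "inner (- sgn a) (y - ?q) \<le> 0" if "y \<in> S" for y
        using a(2)[OF that] by (simp add: sgn_div_norm inner_diff_right mult_left_mono)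
      with True a show ?thesis
        by (intro exI[of _ "- sgn a"] exI[of _ 0]) (auto simp: norm_sgn)
    next
      case False
      have "inner (sgn (u - ?q)) (y - ?q) \<le> 0" if "y \<in> S" for y
        using P_dot[OF that, of u] by (simp add: sgn_div_norm mult_le_0_iff divide_nonpos_nonneg)
      moreover have "u = ?q + of_real (norm (u - ?q)) * sgn (u - ?q)"
        using False by (simp add: sgn_eq)
      ultimately show ?thesis
        using False by (intro exI[of _ "sgn (u - ?q)"] exI[of _ "norm (u - ?q)"]) (auto simp: norm_sgn)
    qed
    then obtain n t where nt: "norm n = 1" "\<forall>y\<in>S. inner n (y - ?q) \<le> 0" "t \<ge> 0" "u = ?q + of_real t * n"
      by blast
    have "w = E ?q + of_real t * n" using \<Psi>_ray nt P_in u by metis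
    moreover have "(E ?q, n) \<in> R" using q nt unfolding R_def by blast
    ultimately show "w \<in> (\<Union>(a, d)\<in>R. closed_ray a d)"
      using nt by (auto simp: closed_ray_def)
  next
    fix w assume "w \<in> (\<Union>(a, d)\<in>R. closed_ray a d)"
    then obtain q n t where q: "q \<in> S - \<Omega>" "norm n = 1" "\<forall>y\<in>S. inner n (y - q) \<le> 0" "t \<ge> 0"
      and w: "w = E q + of_real t * n"
      by (auto simp: R_def closed_ray_def)
    have w\<Psi>: "w = \<Psi> (q + of_real t * n)" using \<Psi>_ray q w by auto
    show "w \<in> - (\<Phi> ` \<Omega>)"
    proof
      assume "w \<in> \<Phi> ` \<Omega>"
      then obtain u where u: "u \<in> \<Omega>" "w = \<Psi> u" using \<Psi>_\<Omega> by auto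
      then have "u = q + of_real t * n" using w\<Psi> inj\<Psi> by (simp add: inj_eq)
      then have "P u = q" using P_ray q by auto
      then show False using P_id u q S by auto
    qed
  qed
  show ?thesis
    unfolding close_to_convex_domain_def
  proof (intro conjI exI[of _ R] op conn nonzero compl)
    show "\<forall>(a, d)\<in>R. \<forall>(b, e)\<in>R. (a, d) \<noteq> (b, e) \<longrightarrow> open_ray a d \<inter> open_ray b e = {}"
      by (intro ballI case_prodI2 impI disj) simp_all
  qed (use assms(3) in simp)
qed

text \<open>The mean value theorem, applied to the component of \<open>\<Phi>\<close> in the direction of the segment.\<close>
lemma strongly_monotone_if_derivative:
  fixes \<Phi> :: "'a::real_inner \<Rightarrow> 'a"
  assumes "convex \<Omega>"
    and deriv: "\<And>x. x \<in> \<Omega> \<Longrightarrow> (\<Phi> has_derivative \<Phi>' x) (at x)"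
    and mono: "\<And>x d. x \<in> \<Omega> \<Longrightarrow> k * (norm d)\<^sup>2 \<le> inner (\<Phi>' x d) d"
    and uv: "u \<in> \<Omega>" "v \<in> \<Omega>"
  shows "k * (norm (u - v))\<^sup>2 \<le> inner (\<Phi> u - \<Phi> v) (u - v)"
proof -
  define d where "d = u - v"
  define l where "l = (\<lambda>t. v + t *\<^sub>R d)"
  have l: "l t \<in> \<Omega>" if "0 \<le> t" "t \<le> 1" for t
  proof -
    have "l t = (1 - t) *\<^sub>R v + t *\<^sub>R u" by (simp add: l_def d_def algebra_simps)
    then show ?thesis using convexD_alt[OF assms(1) uv(2,1)] that by simp
  qed
  have "((\<lambda>t. inner (\<Phi> (l t)) d) has_real_derivative inner (\<Phi>' (l t) d) d) (at t)"
    if "0 \<le> t" "t \<le> 1" for t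
  proof -
    have "(l has_derivative (\<lambda>h. h *\<^sub>R d)) (at t)"
      unfolding l_def by (auto intro!: derivative_eq_intros)
    then have "((\<lambda>t. \<Phi> (l t)) has_derivative (\<lambda>h. \<Phi>' (l t) (h *\<^sub>R d))) (at t)"
      using has_derivative_compose deriv[OF l[OF that]] by blast
    then have "((\<lambda>t. inner (\<Phi> (l t)) d) has_derivative (\<lambda>h. inner (\<Phi>' (l t) (h *\<^sub>R d)) d)) (at t)"
      by (rule has_derivative_inner_left)
    moreover have "\<Phi>' (l t) (h *\<^sub>R d) = h *\<^sub>R \<Phi>' (l t) d" for h
      by (rule linear_scale[OF bounded_linear.linear[OF has_derivative_bounded_linear[OF deriv[OF l[OF that]]]]])
    ultimately show ?thesis
      by (simp add: has_field_derivative_def mult_commute_abs)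
  qed
  then obtain t where "0 < t" "t < 1"
    "inner (\<Phi> (l 1)) d - inner (\<Phi> (l 0)) d = (1 - 0) * inner (\<Phi>' (l t) d) d"
    using MVT2[of 0 1 "\<lambda>t. inner (\<Phi> (l t)) d" "\<lambda>t. inner (\<Phi>' (l t) d) d"] by auto
  then have "k * (norm d)\<^sup>2 \<le> inner (\<Phi> (l 1)) d - inner (\<Phi> (l 0)) d"
    using mono[OF l, of t d] by simp
  then show ?thesis
    by (simp add: l_def d_def inner_diff_left)
qed

section \<open>Shears of convex functions with small dilatation\<close>

text \<open>
  The image of the disc of radius \<open>c\<close> under \<open>w \<mapsto> 1 / (1 - w)\<close> lies to the right of \<open>1 / (1 + c)\<close>;
  for \<open>c = 1\<close> it lies in the half-plane to the right of \<open>1 / 2\<close>.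
\<close>
lemma Re_inverse_one_minus_ge:
  fixes w :: complex
  assumes "norm w \<le> c" "norm w < 1"
  shows "1 / (1 + c) \<le> Re (1 / (1 - w))"
proof -
  let ?n = "norm w"
  have n1: "?n < 1" by (rule assms(2))
  then have "Re w < 1" using complex_Re_le_cmod[of w] by simp
  have "0 \<le> (1 - ?n) * (?n + Re w)"
    using n1 abs_Re_le_cmod[of w] by (intro mult_nonneg_nonneg) (simp_all add: abs_le_iff)
  moreover have nsq: "(norm (1 - w))\<^sup>2 = 1 - 2 * Re w + ?n\<^sup>2"
    by (simp add: cmod_power2) (simp add: power2_eq_square algebra_simps)
  ultimately have "(norm (1 - w))\<^sup>2 \<le> (1 - Re w) * (1 + ?n)"
    by (simp add: power2_eq_square algebra_simps)
  also have "\<dots> \<le> (1 - Re w) * (1 + c)"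
    using assms \<open>Re w < 1\<close> by (intro mult_left_mono) auto
  finally have le: "(norm (1 - w))\<^sup>2 \<le> (1 - Re w) * (1 + c)" .
  have "1 - w \<noteq> 0" using n1 by auto
  then have pos: "(norm (1 - w))\<^sup>2 > 0" by simp
  have "1 + c > 0" using assms norm_ge_zero[of w] by linarith
  then have "1 / (1 + c) \<le> (1 - Re w) / (norm (1 - w))\<^sup>2"
    using le pos by (simp add: field_simps)
  also have "\<dots> = Re (1 / (1 - w))"
    by (simp add: Re_divide cmod_power2)
  finally show ?thesis .
qed

text \<open>
  The bound on \<open>c\<close> says \<open>c < sqrt 2 - 1\<close> and is exactly what makes \<open>k = 1 / (1 + c) - c / (1 - c)\<close>
  positive.  It bounds the real part of the holomorphic derivative \<open>p\<close> from below against the modulus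
  of the antiholomorphic derivative \<open>q\<close>, uniformly in \<open>\<mu>\<close>.
\<close>
lemma shear_of_convex_close_to_convex:
  assumes H: "H holomorphic_on unit_disc" and G: "G holomorphic_on unit_disc"
    and inj: "inj_on (\<lambda>z. H z - G z) unit_disc"
    and conv: "convex ((\<lambda>z. H z - G z) ` unit_disc)"
    and w: "\<And>z. z \<in> unit_disc \<Longrightarrow> deriv G z = w z * deriv H z"
    and c: "\<And>z. z \<in> unit_disc \<Longrightarrow> norm (w z) \<le> c" "0 \<le> c" "c\<^sup>2 + 2 * c < 1"
    and \<mu>: "norm \<mu> = 1"
  shows "close_to_convex_mapping (\<lambda>z. H z + \<mu> * cnj (G z))"
proof -
  define f where "f = (\<lambda>z. H z - G z)"
  define \<Omega> where "\<Omega> = f ` unit_disc"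
  have c1: "c < 1"
  proof (rule ccontr)
    assume "\<not> c < 1"
    then show False using c(3) zero_le_power2[of c] by linarith
  qed
  define k where "k = 1 / (1 + c) - c / (1 - c)"
  have k: "k > 0"
    using c c1 unfolding k_def by (simp add: field_simps power2_eq_square)
  have f: "f holomorphic_on unit_disc" "inj_on f unit_disc"
    using H G inj by (auto simp: f_def intro: holomorphic_intros)
  then have "open \<Omega>"
    unfolding \<Omega>_def by (intro open_mapping_thm3) auto
  obtain Z where Z: "Z holomorphic_on \<Omega>" "\<And>z. z \<in> unit_disc \<Longrightarrow> deriv f z * deriv Z (f z) = 1"
    "\<And>z. z \<in> unit_disc \<Longrightarrow> Z (f z) = z"
    using holomorphic_has_inverse[OF f(1) open_ball f(2)] unfolding \<Omega>_def by metis
  define p where "p = (\<lambda>u. 1 / (1 - w (Z u)))"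
  define q where "q = (\<lambda>u. w (Z u) / (1 - w (Z u)))"
  define \<Phi> where "\<Phi> = (\<lambda>u. H (Z u) + \<mu> * cnj (G (Z u)))"
  define \<Phi>' where "\<Phi>' = (\<lambda>u d. p u * d + \<mu> * cnj (q u * d))"
  have w1: "norm (1 - w (Z u)) \<ge> 1 - c" "norm (w (Z u)) \<le> c" if "u \<in> \<Omega>" for u
    using c(1)[of "Z u"] that Z(3) norm_triangle_ineq2[of 1 "w (Z u)"] by (auto simp: \<Omega>_def)
  have p: "norm (p u) \<le> 1 / (1 - c)" "Re (p u) \<ge> 1 / (1 + c)" and q: "norm (q u) \<le> c / (1 - c)"
    if "u \<in> \<Omega>" for u
    using w1[OF that] c1 c(2) Re_inverse_one_minus_ge[OF w1(2)[OF that]]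
    by (auto simp: p_def q_def norm_divide intro!: frac_le)
  have deriv_comp: "((\<lambda>u. K (Z u)) has_field_derivative deriv K (Z u) * deriv Z u) (at u)"
    if "K holomorphic_on unit_disc" "u \<in> \<Omega>" for K u
  proof -
    have "Z u \<in> unit_disc" using that Z(3) by (auto simp: \<Omega>_def)
    then have "(K has_field_derivative deriv K (Z u)) (at (Z u))"
      using that by (intro holomorphic_derivI[of K unit_disc]) auto
    moreover have "(Z has_field_derivative deriv Z u) (at u)"
      using Z(1) \<open>open \<Omega>\<close> that by (intro holomorphic_derivI[of Z \<Omega>])
    ultimately show ?thesis by (rule DERIV_chain2)
  qed
  have HG': "deriv H (Z u) * deriv Z u = p u" "deriv G (Z u) * deriv Z u = q u" if u: "u \<in> \<Omega>" for u
  proof -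
    obtain z where z: "z \<in> unit_disc" "u = f z" using u by (auto simp: \<Omega>_def)
    have "deriv f z = deriv H z - deriv G z"
      unfolding f_def using H G z by (intro deriv_diff) (auto simp: holomorphic_on_imp_differentiable_at)
    then have "deriv f z = (1 - w z) * deriv H z"
      using w[OF z(1)] by (simp add: algebra_simps)
    then have "(1 - w z) * (deriv H z * deriv Z u) = 1"
      using Z(2)[OF z(1)] z(2) by (simp add: mult.assoc)
    moreover have "1 - w z \<noteq> 0" using w1(1)[OF u] c1 Z(3) z by auto
    ultimately have 1: "deriv H z * deriv Z u = 1 / (1 - w z)" by (simp add: field_simps)
    then show "deriv H (Z u) * deriv Z u = p u" by (simp add: p_def z(2) Z(3)[OF z(1)])
    have "deriv G z * deriv Z u = w z * (deriv H z * deriv Z u)" using w[OF z(1)] by simp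
    also have "\<dots> = w z / (1 - w z)" unfolding 1 by simp
    finally show "deriv G (Z u) * deriv Z u = q u" by (simp add: q_def z(2) Z(3)[OF z(1)])
  qed
  have \<Phi>': "(\<Phi> has_derivative \<Phi>' u) (at u)" if "u \<in> \<Omega>" for u
  proof -
    have "((\<lambda>u. H (Z u)) has_derivative (\<lambda>d. p u * d)) (at u)"
      "((\<lambda>u. G (Z u)) has_derivative (\<lambda>d. q u * d)) (at u)"
      using deriv_comp[OF H that] deriv_comp[OF G that] HG'[OF that]
      by (simp_all add: has_field_derivative_def)
    then show ?thesis
      unfolding \<Phi>_def \<Phi>'_def by (intro has_derivative_add has_derivative_mult_right has_derivative_cnj)
  qed
  have "onorm (\<Phi>' u) \<le> (1 + c) / (1 - c)" if "u \<in> \<Omega>" for u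
  proof (rule onorm_le)
    fix d
    have "norm (\<Phi>' u d) \<le> norm (p u) * norm d + norm (q u) * norm d"
      unfolding \<Phi>'_def using norm_triangle_ineq[of "p u * d" "\<mu> * cnj (q u * d)"]
      by (simp add: norm_mult \<mu>)
    also have "\<dots> \<le> 1 / (1 - c) * norm d + c / (1 - c) * norm d"
      by (intro add_mono mult_right_mono p q that) auto
    finally show "norm (\<Phi>' u d) \<le> (1 + c) / (1 - c) * norm d"
      by (simp add: add_divide_distrib distrib_right)
  qed
  then have lip: "((1 + c) / (1 - c))-lipschitz_on \<Omega> \<Phi>"
    using conv c(2) c1
    by (intro bounded_derivative_imp_lipschitz[OF has_derivative_at_withinI[OF \<Phi>']]) (auto simp: \<Omega>_def f_def)
  have "k * (norm d)\<^sup>2 \<le> inner (\<Phi>' u d) d" if "u \<in> \<Omega>" for u d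
  proof -
    have "inner (p u * d) d = Re (p u) * (norm d)\<^sup>2"
      unfolding inner_complex_def cmod_power2 by (simp add: power2_eq_square algebra_simps)
    moreover have "\<dots> \<ge> 1 / (1 + c) * (norm d)\<^sup>2"
      by (intro mult_right_mono p that) auto
    moreover have "\<bar>inner (\<mu> * cnj (q u * d)) d\<bar> \<le> norm (q u) * norm d * norm d"
      using Cauchy_Schwarz_ineq2[of "\<mu> * cnj (q u * d)" d] by (simp add: norm_mult \<mu>)
    moreover have "norm (q u) * norm d * norm d \<le> c / (1 - c) * (norm d)\<^sup>2"
      unfolding power2_eq_square mult.assoc by (intro mult_right_mono q that) auto
    ultimately show ?thesis
      unfolding \<Phi>'_def k_def inner_add_left left_diff_distrib by linarith
  qed
  then have mono: "k * (norm (u - v))\<^sup>2 \<le> inner (\<Phi> u - \<Phi> v) (u - v)" if "u \<in> \<Omega>" "v \<in> \<Omega>" for u v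
    using strongly_monotone_if_derivative[OF _ \<Phi>' _ that] conv by (simp add: \<Omega>_def f_def)
  have "\<Omega> \<noteq> {}" "convex \<Omega>" using conv by (auto simp: \<Omega>_def f_def)
  then have ctc: "close_to_convex_domain (\<Phi> ` \<Omega>)"
    using strongly_monotone_image_close_to_convex[OF \<open>open \<Omega>\<close> _ _ lip k mono] by blast
  have \<Phi>f: "\<Phi> (f z) = H z + \<mu> * cnj (G z)" if "z \<in> unit_disc" for z
    using Z(3)[OF that] by (simp add: \<Phi>_def)
  have "\<Phi> ` \<Omega> = (\<lambda>z. H z + \<mu> * cnj (G z)) ` unit_disc"
    unfolding \<Omega>_def image_image by (rule image_cong) (auto simp: \<Phi>f)
  moreover have "inj_on (\<lambda>z. H z + \<mu> * cnj (G z)) unit_disc"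
  proof (rule inj_onI)
    fix x y assume xy: "x \<in> unit_disc" "y \<in> unit_disc" "H x + \<mu> * cnj (G x) = H y + \<mu> * cnj (G y)"
    then have "\<Phi> (f x) = \<Phi> (f y)" using \<Phi>f by simp
    then have "f x = f y"
      using mono[of "f x" "f y"] xy(1,2) k by (simp add: \<Omega>_def mult_le_0_iff)
    then show "x = y" using f(2) xy(1,2) by (simp add: inj_on_eq_iff)
  qed
  moreover have "harmonic_mapping (\<lambda>z. H z + \<mu> * cnj (G z))"
    unfolding harmonic_mapping_def harmonic_decomp_def
    \<comment> \<open>The factor \<open>\<mu>\<close> moves under the conjugation.\<close>
    by (rule exI[of _ H], rule exI[of _ "\<lambda>z. cnj \<mu> * G z"]) (use H G in \<open>auto intro: holomorphic_intros\<close>)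
  ultimately show ?thesis
    using ctc by (simp add: close_to_convex_mapping_def)
qed

section \<open>The integral transform of a starlike function\<close>

lemma holomorphic_divide_by_z:
  assumes "\<phi> holomorphic_on S" "open S" "0 \<in> S" "\<phi> 0 = 0"
  shows "(\<lambda>z. if z = 0 then deriv \<phi> 0 else \<phi> z / z) holomorphic_on S"
proof (rule removable_singularity)
  have "(\<phi> has_field_derivative deriv \<phi> 0) (at 0)"
    using assms by (intro holomorphic_derivI)
  then show "(\<lambda>z. \<phi> z / z) \<midarrow>0\<rightarrow> deriv \<phi> 0"
    by (simp add: has_field_derivative_iff assms(4))
  show "(\<lambda>z. \<phi> z / z) holomorphic_on S - {0}"
    using assms(1) by (intro holomorphic_intros) (auto intro: holomorphic_on_subset)
qed (rule assms)

text \<open>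
  Here \<open>L\<close> is the logarithm of \<open>\<phi> z / (z (1 - z)\<^sup>\<beta>)\<close>, so \<open>z L' = z \<phi>'/\<phi> - 1 + \<beta> z / (1 - z)\<close>.  The first
  term has positive real part, and \<open>Re (z / (1 - z)) \<ge> - 1 / 2\<close> in the disc.
\<close>
lemma C_base_logarithm:
  assumes \<phi>: "\<phi> \<in> starlike_of_order \<delta>" and "0 \<le> \<delta>" "0 \<le> \<beta>"
  obtains L where "L holomorphic_on unit_disc"
    "\<And>a z. power_branch (C_base \<beta> \<phi>) a z = exp (of_real a * L z)"
    "\<And>z. z \<in> unit_disc \<Longrightarrow> Re (z * deriv L z) \<ge> - (1 + \<beta> / 2)"
proof -
  define e where "e = (\<lambda>z. exp (- (of_real \<beta> * Ln (1 - z))))"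
  define s where "s = (\<lambda>z. if z = 0 then deriv \<phi> 0 else \<phi> z / z)"
  have \<phi>': "\<phi> holomorphic_on unit_disc" "\<phi> 0 = 0" "deriv \<phi> 0 = 1"
    "\<And>z. z \<in> unit_disc \<Longrightarrow> z \<noteq> 0 \<Longrightarrow> \<phi> z \<noteq> 0"
    "\<And>z. z \<in> unit_disc \<Longrightarrow> z \<noteq> 0 \<Longrightarrow> Re (z * deriv \<phi> z / \<phi> z) > \<delta>"
    using \<phi> by (auto simp: starlike_of_order_def)
  have nonpos: "1 - z \<notin> \<real>\<^sub>\<le>\<^sub>0" if "z \<in> unit_disc" for z :: complex
    using that complex_Re_le_cmod[of z] by (auto simp: complex_nonpos_Reals_iff)
  have base: "C_base \<beta> \<phi> z = s z * e z" if "z \<in> unit_disc" for z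
    using that unfolding C_base_def s_def e_def by (auto simp: powr_def exp_minus divide_inverse)
  have "s holomorphic_on unit_disc"
    unfolding s_def by (rule holomorphic_divide_by_z) (use \<phi>' in auto)
  moreover have "e holomorphic_on unit_disc"
    unfolding e_def by (intro holomorphic_intros) (use nonpos in auto)
  ultimately have hol: "C_base \<beta> \<phi> holomorphic_on unit_disc"
    using base by (metis (no_types, lifting) holomorphic_on_mult holomorphic_transform)
  have nz: "C_base \<beta> \<phi> z \<noteq> 0" if "z \<in> unit_disc" for z
    using \<phi>'(3) \<phi>'(4)[OF that] base[OF that] by (auto simp: s_def e_def)
  have base0: "C_base \<beta> \<phi> 0 = 1" using \<phi>' by (simp add: C_base_def)
  let ?is_log = "\<lambda>L. L holomorphic_on unit_disc \<and> L 0 = 0 \<and> (\<forall>z\<in>unit_disc. exp (L z) = C_base \<beta> \<phi> z)"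
  have "\<exists>L. ?is_log L"
  proof -
    obtain M where M: "M holomorphic_on unit_disc" "\<And>z. z \<in> unit_disc \<Longrightarrow> exp (M z) = C_base \<beta> \<phi> z"
      using holomorphic_logarithm_exists[OF convex_ball open_ball hol nz, of 0] by auto
    then have "exp (M 0) = 1" using base0 by simp
    then have "?is_log (\<lambda>z. M z - M 0)"
      using M by (auto simp: exp_diff intro: holomorphic_intros)
    then show ?thesis by blast
  qed
  then have log: "?is_log (SOME L. ?is_log L)" by (rule someI_ex)
  define L where "L = (SOME L. ?is_log L)"
  have L: "L holomorphic_on unit_disc" "\<And>z. z \<in> unit_disc \<Longrightarrow> exp (L z) = C_base \<beta> \<phi> z"
    using log unfolding L_def by blast+
  have "Re (z * deriv L z) \<ge> - (1 + \<beta> / 2)" if z: "z \<in> unit_disc" for z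
  proof (cases "z = 0")
    case True
    then show ?thesis using \<open>0 \<le> \<beta>\<close> by simp
  next
    case False
    have z1: "1 - z \<noteq> 0" using z by auto
    have "(e has_field_derivative e z * (of_real \<beta> / (1 - z))) (at z)"
      unfolding e_def using nonpos[OF z] z1
      by (auto intro!: derivative_eq_intros simp: divide_inverse mult_ac)
    moreover have "(\<phi> has_field_derivative deriv \<phi> z) (at z)"
      using \<phi>'(1) z by (intro holomorphic_derivI) auto
    ultimately have "((\<lambda>z. \<phi> z / z * e z) has_field_derivative
        \<phi> z / z * (e z * (of_real \<beta> / (1 - z))) + (deriv \<phi> z * z - \<phi> z * 1) / (z * z) * e z) (at z)"
      using False by (intro DERIV_mult' DERIV_divide DERIV_ident)
    moreover have "\<phi> y / y * e y = exp (L y)" if "y \<in> unit_disc - {0}" for y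
      using that base L(2) by (simp add: s_def)
    ultimately have "((\<lambda>z. exp (L z)) has_field_derivative
        \<phi> z / z * (e z * (of_real \<beta> / (1 - z))) + (deriv \<phi> z * z - \<phi> z * 1) / (z * z) * e z) (at z)"
      using z False by (elim has_field_derivative_transform_within_open[where S = "unit_disc - {0}"]) auto
    moreover have "((\<lambda>z. exp (L z)) has_field_derivative exp (L z) * deriv L z) (at z)"
      using L(1) z by (intro DERIV_chain2[OF DERIV_exp] holomorphic_derivI) auto
    ultimately have "exp (L z) * deriv L z
        = \<phi> z / z * (e z * (of_real \<beta> / (1 - z))) + (deriv \<phi> z * z - \<phi> z * 1) / (z * z) * e z"
      using DERIV_unique by blast
    moreover have "exp (L z) = \<phi> z / z * e z" "e z \<noteq> 0"
      using z False base L(2) by (auto simp: s_def e_def)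
    ultimately have "e z * (\<phi> z / z * deriv L z)
        = e z * (\<phi> z / z * (of_real \<beta> / (1 - z)) + (deriv \<phi> z * z - \<phi> z) / (z * z))"
      by (simp add: algebra_simps)
    then have "\<phi> z / z * deriv L z
        = \<phi> z / z * (of_real \<beta> / (1 - z)) + (deriv \<phi> z * z - \<phi> z) / (z * z)"
      using mult_left_cancel[OF \<open>e z \<noteq> 0\<close>] by blast
    then have "(z * z / \<phi> z) * (\<phi> z / z * deriv L z)
        = (z * z / \<phi> z) * (\<phi> z / z * (of_real \<beta> / (1 - z)) + (deriv \<phi> z * z - \<phi> z) / (z * z))"
      by simp
    then have "z * deriv L z = z * deriv \<phi> z / \<phi> z - 1 + of_real \<beta> * (z / (1 - z))"
      using False \<phi>'(4)[OF z False] by (simp add: distrib_left diff_divide_distrib mult_ac)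
        (simp add: field_simps)
    moreover have "z / (1 - z) = 1 / (1 - z) - 1" using z1 by (simp add: field_simps)
    ultimately have "Re (z * deriv L z) = Re (z * deriv \<phi> z / \<phi> z) - 1 + \<beta> * (Re (1 / (1 - z)) - 1)"
      by simp
    moreover have "Re (z * deriv \<phi> z / \<phi> z) > 0" using \<phi>'(5)[OF z False] \<open>0 \<le> \<delta>\<close> by simp
    moreover have "1 / (1 + 1) \<le> Re (1 / (1 - z))"
      using z by (intro Re_inverse_one_minus_ge) auto
    then have "\<beta> * (- 1 / 2) \<le> \<beta> * (Re (1 / (1 - z)) - 1)"
      using \<open>0 \<le> \<beta>\<close> by (intro mult_left_mono) auto
    ultimately show ?thesis by linarith
  qed
  moreover have "power_branch (C_base \<beta> \<phi>) a z = exp (of_real a * L z)" for a z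
    unfolding power_branch_def L_def ..
  ultimately show ?thesis using L(1) that by blast
qed

text \<open>
  The derivative of the transform is \<open>exp (\<alpha> L)\<close>, hence \<open>z f''/f' = \<alpha> z L'\<close>; the rotation only moves the
  point at which this is evaluated.
\<close>
lemma C_rot_convex:
  assumes \<phi>: "\<phi> \<in> starlike_of_order \<delta>" and "0 \<le> \<delta>" "0 \<le> \<beta>"
    and \<alpha>: "0 \<le> \<alpha>" "\<alpha> * (1 + \<beta> / 2) < 1"
  shows "inj_on (C_rot \<theta> \<alpha> \<beta> \<phi>) unit_disc" "convex (C_rot \<theta> \<alpha> \<beta> \<phi> ` unit_disc)"
proof -
  obtain L where L: "L holomorphic_on unit_disc"
    "\<And>a z. power_branch (C_base \<beta> \<phi>) a z = exp (of_real a * L z)"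
    "\<And>z. z \<in> unit_disc \<Longrightarrow> Re (z * deriv L z) \<ge> - (1 + \<beta> / 2)"
    using C_base_logarithm[OF assms(1-3)] by blast
  define p where "p = (\<lambda>z. exp (of_real \<alpha> * L z))"
  have p_eq: "power_branch (C_base \<beta> \<phi>) \<alpha> = p" using L(2) by (auto simp: p_def)
  have "p holomorphic_on unit_disc" unfolding p_def using L(1) by (intro holomorphic_intros)
  then obtain J where J: "\<And>z. z \<in> unit_disc \<Longrightarrow> (J has_field_derivative p z) (at z)"
    using holomorphic_convex_primitive'[OF convex_ball open_ball, of p 0 1] by (metis at_within_open open_ball)
  have C_op: "C_op \<alpha> \<beta> \<phi> z = J z - J 0" if z: "z \<in> unit_disc" for z
  proof -
    have "closed_segment 0 z \<subseteq> unit_disc" using z by (intro closed_segment_subset) auto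
    then have "(p has_contour_integral J (pathfinish (linepath 0 z)) - J (pathstart (linepath 0 z))) (linepath 0 z)"
      by (intro contour_integral_primitive[of unit_disc] valid_path_linepath has_field_derivative_at_within[OF J])
        (simp_all only: path_image_linepath)
    then show ?thesis unfolding C_op_def p_eq by (simp add: contour_integral_unique)
  qed
  define r where "r = exp (\<i> * of_real \<theta>)"
  have r: "norm r = 1" "r \<noteq> 0" "exp (- \<i> * of_real \<theta>) = inverse r"
    by (auto simp: r_def exp_minus)
  have rD: "r * z \<in> unit_disc" if "z \<in> unit_disc" for z
    using that r by (simp add: norm_mult)
  define f where "f = C_rot \<theta> \<alpha> \<beta> \<phi>"
  have f': "(f has_field_derivative p (r * z)) (at z)" if z: "z \<in> unit_disc" for z
  proof -
    have "((\<lambda>z. inverse r * (J (r * z) - J 0)) has_field_derivative inverse r * (p (r * z) * r - 0)) (at z)"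
      by (intro DERIV_cmult DERIV_diff DERIV_const DERIV_chain2[where f = J] J[OF rD[OF z]] DERIV_cmult_Id)
    moreover have "inverse r * (p (r * z) * r - 0) = p (r * z)" using r(2) by simp
    ultimately have "((\<lambda>z. inverse r * (J (r * z) - J 0)) has_field_derivative p (r * z)) (at z)"
      by (simp only:)
    then show ?thesis
      by (rule has_field_derivative_transform_within_open[OF _ open_ball z])
        (use C_op rD r in \<open>simp add: f_def C_rot_def r_def[symmetric]\<close>)
  qed
  then have deriv_f: "deriv f z = p (r * z)" if "z \<in> unit_disc" for z
    using that DERIV_imp_deriv by blast
  have deriv2_f: "deriv (deriv f) z = p (r * z) * (of_real \<alpha> * (deriv L (r * z) * r))" if z: "z \<in> unit_disc" for z
  proof -
    have "(L has_field_derivative deriv L (r * z)) (at (r * z))"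
      using L(1) rD[OF z] by (intro holomorphic_derivI) auto
    then have "((\<lambda>z. p (r * z)) has_field_derivative p (r * z) * (of_real \<alpha> * (deriv L (r * z) * r))) (at z)"
      unfolding p_def by (intro DERIV_chain2[OF DERIV_exp] DERIV_cmult DERIV_chain2[of L] DERIV_cmult_Id)
    then have "(deriv f has_field_derivative p (r * z) * (of_real \<alpha> * (deriv L (r * z) * r))) (at z)"
      by (rule has_field_derivative_transform_within_open[OF _ open_ball z]) (simp add: deriv_f)
    then show ?thesis by (rule DERIV_imp_deriv)
  qed
  have "f holomorphic_on unit_disc"
    unfolding holomorphic_on_open[OF open_ball] using f' by blast
  moreover have "\<forall>z\<in>unit_disc. deriv f z \<noteq> 0" by (simp add: deriv_f p_def)
  moreover have "\<forall>z\<in>unit_disc. Re (1 + z * (deriv (deriv f) z / deriv f z)) > 0"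
  proof
    fix z :: complex assume z: "z \<in> unit_disc"
    have "z * (deriv (deriv f) z / deriv f z) = of_real \<alpha> * ((r * z) * deriv L (r * z))"
      using z by (simp add: deriv_f deriv2_f p_def mult_ac)
    then have "Re (1 + z * (deriv (deriv f) z / deriv f z)) = 1 + \<alpha> * Re ((r * z) * deriv L (r * z))"
      by simp
    also have "\<dots> \<ge> 1 + \<alpha> * (- (1 + \<beta> / 2))"
      using L(3)[OF rD[OF z]] \<alpha>(1) by (intro add_left_mono mult_left_mono)
    finally show "Re (1 + z * (deriv (deriv f) z / deriv f z)) > 0"
      using \<alpha>(2) by linarith
  qed
  ultimately show "inj_on (C_rot \<theta> \<alpha> \<beta> \<phi>) unit_disc" "convex (C_rot \<theta> \<alpha> \<beta> \<phi> ` unit_disc)"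
    using convex_univalent_criterion[of f] by (simp_all add: f_def)
qed

theorem theorem5p5:
  fixes \<phi> F :: "complex \<Rightarrow> complex" and \<alpha> \<beta> \<delta> \<theta> :: real
  assumes "0 \<le> \<delta>" and "\<delta> < 1"
    and "\<phi> \<in> starlike_of_order \<delta>"
    and "\<beta> \<ge> 0"
    and "\<theta> \<in> {0..<pi}"
    and "sense_preserving F"
    and "horizontal_shear F (C_rot \<theta> \<alpha> \<beta> \<phi>) (\<lambda>z. of_real (\<alpha> * (1 + \<beta>)) * z / 2)"
    and "\<alpha> \<in> {0..1 / ((1 + \<beta>) * sqrt 2)}"
  shows "F \<in> SHCC"
proof -
  define w where "w = (\<lambda>z :: complex. of_real (\<alpha> * (1 + \<beta>)) * z / 2)"
  define m where "m = \<alpha> * (1 + \<beta>)"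
  have "\<alpha> * (1 + \<beta>) \<le> 1 / ((1 + \<beta>) * sqrt 2) * (1 + \<beta>)"
    using assms(4,8) by (intro mult_right_mono) auto
  then have m: "0 \<le> m" "m \<le> 1 / sqrt 2"
    using assms(4,8) by (auto simp: m_def)
  then have "m\<^sup>2 \<le> (1 / sqrt 2)\<^sup>2" by (intro power_mono)
  then have m2: "m\<^sup>2 \<le> 1 / 2" by (simp add: power_divide)
  \<comment> \<open>The dilatation is bounded by \<open>m / 2\<close>, and \<open>m\<^sup>2 / 4 + m < 1 / 8 + 3 / 4 < 1\<close>.\<close>
  have m34: "m < 3 / 4"
  proof (rule ccontr)
    assume "\<not> m < 3 / 4"
    then have "(3 / 4)\<^sup>2 \<le> m\<^sup>2" by (intro power_mono) auto
    then show False using m2 by (simp add: power2_eq_square)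
  qed
  obtain H G where HG: "harmonic_decomp F H G" "\<And>z. z \<in> unit_disc \<Longrightarrow> H z - G z = C_rot \<theta> \<alpha> \<beta> \<phi> z"
    "\<And>z. z \<in> unit_disc \<Longrightarrow> deriv G z = w z * deriv H z"
    using assms(7) unfolding horizontal_shear_def w_def by blast
  then have hol: "H holomorphic_on unit_disc" "G holomorphic_on unit_disc"
    by (auto simp: harmonic_decomp_def)
  have "\<alpha> * (1 + \<beta> / 2) \<le> m"
    using assms(4,8) unfolding m_def by (intro mult_left_mono) auto
  then have \<alpha>: "0 \<le> \<alpha>" "\<alpha> * (1 + \<beta> / 2) < 1" using m34 assms(8) by auto
  note conv = C_rot_convex[OF assms(3,1,4) \<alpha>, of \<theta>]
  have "inj_on (\<lambda>z. H z - G z) unit_disc" "convex ((\<lambda>z. H z - G z) ` unit_disc)"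
    using conv HG(2) inj_on_cong[of unit_disc "\<lambda>z. H z - G z" "C_rot \<theta> \<alpha> \<beta> \<phi>"]
      image_cong[of unit_disc unit_disc "\<lambda>z. H z - G z" "C_rot \<theta> \<alpha> \<beta> \<phi>"] by simp_all
  moreover have "norm (w z) \<le> m / 2" if "z \<in> unit_disc" for z
  proof -
    have "norm (w z) = m / 2 * norm z" using m(1) by (simp add: w_def m_def norm_mult norm_divide del: of_real_mult)
    also have "\<dots> \<le> m / 2 * 1" using that m(1) by (intro mult_left_mono) auto
    finally show ?thesis by simp
  qed
  moreover have "(m / 2)\<^sup>2 + 2 * (m / 2) < 1"
    using m2 m34 by (simp add: power_divide)
  ultimately have "close_to_convex_mapping (\<lambda>z. H z + \<mu> * cnj (G z))" if "\<mu> \<in> sphere 0 1" for \<mu>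
    using shear_of_convex_close_to_convex[OF hol _ _ HG(3), of "m / 2" \<mu>] m(1) that by simp
  then show ?thesis
    unfolding SHCC_def using assms(6) HG(1) by blast
qed

end
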